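(* Let $X$ be a locally convex Hausdorff topological vector space, and let $C$ be a nonempty convex compact subset of $X$. Suppose that $T_1, T_2 : C \to 2^{C}$ are two commutative upper semicontinuous convex set-valued mappings such that, for $i = 1,2$ and every $x \in C$, $T_i(x)$ is a nonempty closed subset of $X$. Then there exists $x \in C$ such that $x \in T_1(x) \cap T_2(x)$.
   Context: $2^{C}$ denotes the set of all subsets of $C$, and a set-valued mapping $T : C \to 2^{C}$ assigns to each $x\in C$ a subset $T(x) \subseteq C$. Upper semicontinuous: $T$ is upper semicontinuous if for each $x$ in its domain and each open set $V$ of the target with $T(x) \subseteq V$, there is an open neighborhood $U$ of $x$ in the domain such that $T(y) \subseteq V$ for all $y \in U$. Convex mapping: $T : C \to 2^{C}$ is convex if for all $x, y \in C$, all $t \in T(x)$, $z \in T(y)$ and all $\lambda \in (0,1)$ one has $\lambda t + (1-\lambda) z \in T(\lambda x + (1-\lambda) y)$. Composition and commutativity: $T \circ S(x) = \bigcup_{y \in S(x)} T(y)$. $T$ and $S$ are commutative if $T \circ S(x) = S \circ T(x)$ for all $x$ in the domain. *)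

theory Defs
  imports "HOL-Analysis.Analysis"
begin

class topological_real_vector = real_vector + topological_ab_group_add +
  assumes tendsto_scaleR_Pair:
    "LIM x (nhds a \<times>\<^sub>F nhds b). fst x *\<^sub>R snd x :> nhds (a *\<^sub>R b)"

text \<open>
  The Hausdorff axiom is not part of the following class; it is requested separately through the
  sort \<^class>\<open>t2_space\<close>. The axiom spells out \<^const>\<open>convex\<close>, which cannot be used in a
  class specification; the lemma \<open>locally_convex_0\<close> restates it with \<^const>\<open>convex\<close>.
\<close>

class locally_convex_space = topological_real_vector +
  assumes locally_convex_0_raw:
    "\<lbrakk>open U; 0 \<in> U\<rbrakk> \<Longrightarrow> \<exists>V. open V \<and>
       (\<forall>x\<in>V. \<forall>y\<in>V. \<forall>u\<ge>0. \<forall>v\<ge>0. u + v = 1 \<longrightarrow> u *\<^sub>R x + v *\<^sub>R y \<in> V) \<and>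
       0 \<in> V \<and> V \<subseteq> U"

lemma locally_convex_0:
  fixes U :: "'a::locally_convex_space set"
  assumes "open U" "0 \<in> U"
  shows "\<exists>V. open V \<and> convex V \<and> 0 \<in> V \<and> V \<subseteq> U"
  unfolding convex_def using locally_convex_0_raw[OF assms] .

instance real_normed_vector \<subseteq> locally_convex_space
proof
  fix a :: real and b :: 'a
  show "LIM x (nhds a \<times>\<^sub>F nhds b). fst x *\<^sub>R snd x :> nhds (a *\<^sub>R b)"
    by (intro tendsto_scaleR filterlim_fst filterlim_snd)
next
  fix U :: "'a set"
  assume "open U" "0 \<in> U"
  then obtain e where "e > 0" "ball 0 e \<subseteq> U"
    using open_contains_ball by blast
  then show "\<exists>V. open V \<and>
       (\<forall>x\<in>V. \<forall>y\<in>V. \<forall>u\<ge>0. \<forall>v\<ge>0. u + v = 1 \<longrightarrow> u *\<^sub>R x + v *\<^sub>R y \<in> V) \<and>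
       0 \<in> V \<and> V \<subseteq> U"
    unfolding convex_def[symmetric] by (intro exI[of _ "ball 0 e"]) auto
qed

text \<open>
  A set-valued mapping from \<open>C\<close> to the subsets of \<open>D\<close> is a function of type
  \<^typ>\<open>'a \<Rightarrow> 'b set\<close> whose values at the points of \<open>C\<close> are subsets of \<open>D\<close>; its values outside
  \<open>C\<close> are irrelevant to all the notions below.
\<close>

definition set_valued_map :: "'a set \<Rightarrow> 'b set \<Rightarrow> ('a \<Rightarrow> 'b set) \<Rightarrow> bool" where
  "set_valued_map C D T \<longleftrightarrow> (\<forall>x\<in>C. T x \<subseteq> D)"

definition upper_semicontinuous_map ::
  "'a topology \<Rightarrow> 'b topology \<Rightarrow> ('a \<Rightarrow> 'b set) \<Rightarrow> bool" where
  "upper_semicontinuous_map A B T \<longleftrightarrow>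
     (\<forall>x\<in>topspace A. \<forall>V. openin B V \<and> T x \<subseteq> V \<longrightarrow>
        (\<exists>U. openin A U \<and> x \<in> U \<and> (\<forall>y\<in>U. T y \<subseteq> V)))"

definition convex_set_valued_on ::
  "'a::real_vector set \<Rightarrow> ('a \<Rightarrow> 'b::real_vector set) \<Rightarrow> bool" where
  "convex_set_valued_on C T \<longleftrightarrow>
     (\<forall>x\<in>C. \<forall>y\<in>C. \<forall>t\<in>T x. \<forall>z\<in>T y. \<forall>l::real. 0 < l \<and> l < 1 \<longrightarrow>
        l *\<^sub>R t + (1 - l) *\<^sub>R z \<in> T (l *\<^sub>R x + (1 - l) *\<^sub>R y))"

definition set_valued_comp :: "('b \<Rightarrow> 'c set) \<Rightarrow> ('a \<Rightarrow> 'b set) \<Rightarrow> 'a \<Rightarrow> 'c set" where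
  "set_valued_comp T S x = (\<Union>y\<in>S x. T y)"

definition commutative_on :: "'a set \<Rightarrow> ('a \<Rightarrow> 'a set) \<Rightarrow> ('a \<Rightarrow> 'a set) \<Rightarrow> bool" where
  "commutative_on C T S \<longleftrightarrow> (\<forall>x\<in>C. set_valued_comp T S x = set_valued_comp S T x)"

end

theory Submission
  imports Defs
begin

text \<open>
  The graph of each mapping is compact and convex. Averaging an orbit
  \<open>x\<^sub>0, \<dots>, x\<^sub>n\<close> with \<open>x\<^sub>i\<^sub>+\<^sub>1 \<in> T x\<^sub>i\<close> gives points of the graph with coordinate difference
  \<open>(x\<^sub>n - x\<^sub>0) / n\<close>, which tends to \<open>0\<close>, so a compact convex relation whose range lies in its
  domain meets the diagonal. If \<open>x \<in> T\<^sub>1 x\<close>, then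
  \<open>T\<^sub>2 x \<subseteq> T\<^sub>2 (T\<^sub>1 x) = T\<^sub>1 (T\<^sub>2 x)\<close>, so the inverse of \<open>T\<^sub>1\<close> has nonempty values on \<open>T\<^sub>2 x\<close> and
  therefore \<open>T\<^sub>1\<close> has a fixed point in \<open>T\<^sub>2 x\<close>. Hence \<open>T\<^sub>2\<close> restricts to the fixed point set
  of \<open>T\<^sub>1\<close> with nonempty values, and a fixed point of this restriction is a common fixed point.
\<close>

lemma continuous_on_scaleR_pair:
  "continuous_on UNIV (\<lambda>p. fst p *\<^sub>R snd p :: 'a::topological_real_vector)"
  unfolding continuous_on_def
proof
  fix p :: "real \<times> 'a"
  show "((\<lambda>p. fst p *\<^sub>R snd p) \<longlongrightarrow> fst p *\<^sub>R snd p) (at p within UNIV)"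
    using tendsto_scaleR_Pair[of "fst p" "snd p"]
    by (simp add: nhds_prod[symmetric] tendsto_mono[OF at_within_le_nhds])
qed

text \<open>Scalar multiplication maps \<open>{0} \<times> K\<close> to \<open>0\<close>, so by the
  tube lemma it still maps \<open>R \<times> K\<close> into \<open>U\<close> for some neighbourhood
  \<open>R\<close> of \<open>0\<close>, and \<open>R\<close> contains \<open>1/n\<close> for large
  \<open>n\<close>.\<close>

lemma exists_inverse_scaleR_compact_subset:
  fixes K U :: "'a::topological_real_vector set"
  assumes "compact K" "open U" "0 \<in> U"
  shows "\<exists>n>0. \<forall>y\<in>K. inverse (real n) *\<^sub>R y \<in> U"
proof -
  let ?W = "(\<lambda>p. fst p *\<^sub>R snd p) -` U :: (real \<times> 'a) set"
  have "open ?W"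
    using assms(2) continuous_on_scaleR_pair by (rule open_vimage)
  moreover have "{0} \<times> K \<subseteq> ?W"
    using assms(3) by auto
  ultimately obtain R where R: "0 \<in> R" "open R" "R \<times> K \<subseteq> ?W"
    using Elementary_Topology.tube_lemma[OF assms(1), of ?W 0] by blast
  have "\<forall>\<^sub>F n in sequentially. inverse (real n) \<in> R"
    using topological_tendstoD[OF lim_inverse_n R(2,1)] .
  then obtain N where "\<And>n. n \<ge> N \<Longrightarrow> inverse (real n) \<in> R"
    unfolding eventually_sequentially by blast
  \<comment> \<open>\<open>N\<close> itself may be \<open>0\<close>, so the positive index
    \<open>Suc N\<close> is taken.\<close>
  then have "inverse (real (Suc N)) \<in> R"
    by (meson le_SucI order_refl)
  with R(3) show ?thesis
    by (intro exI[of _ "Suc N"]) auto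
qed

lemma compact_convex_relation_fixed_point:
  fixes G :: "('a::{topological_real_vector, t2_space} \<times> 'a) set"
  assumes "compact G" "convex G" "G \<noteq> {}" "snd ` G \<subseteq> fst ` G"
  shows "\<exists>x. (x, x) \<in> G"
proof (rule ccontr)
  assume no_fix: "\<nexists>x. (x, x) \<in> G"
  \<comment> \<open>\<open>G\<close> meets the diagonal exactly when \<open>0 \<in> D\<close>.
    Otherwise \<open>- D\<close> is an open neighbourhood of \<open>0\<close>, because the compact
    set \<open>D\<close> is closed.\<close>
  define D where "D = (\<lambda>p. snd p - fst p) ` G"
  have "compact D"
    unfolding D_def by (intro compact_continuous_image continuous_intros assms)
  have "linear (\<lambda>p::'a \<times> 'a. snd p - fst p)"
    by (rule linearI) (auto simp: algebra_simps)
  then have "convex D"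
    unfolding D_def using assms(2) by (rule convex_linear_image)
  have "0 \<notin> D"
    using no_fix by (auto simp: D_def)
  have "\<exists>z. (x, z) \<in> G \<and> z \<in> fst ` G" if "x \<in> fst ` G" for x
    using that assms(4) by force
  then obtain f where f: "\<And>x. x \<in> fst ` G \<Longrightarrow> (x, f x) \<in> G \<and> f x \<in> fst ` G"
    by metis
  obtain a where "a \<in> fst ` G"
    using assms(3) by blast
  define x where "x n = (f ^^ n) a" for n
  have x_dom: "x n \<in> fst ` G" for n
    by (induction n) (use \<open>a \<in> fst ` G\<close> f in \<open>auto simp: x_def\<close>)
  have step: "x (Suc n) - x n \<in> D" for n
    using f[OF x_dom[of n]] by (force simp: D_def x_def)
  \<comment> \<open>One compact set holds the differences \<open>x n - x 0\<close> for all
    \<open>n\<close> at once, so \<open>n\<close> can be chosen uniformly.\<close>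
  define K where "K = (\<lambda>p. fst p - snd p) ` (fst ` G \<times> fst ` G)"
  have "compact (fst ` G)"
    by (intro compact_continuous_image continuous_intros assms)
  then have "compact K"
    unfolding K_def by (intro compact_continuous_image[OF _ compact_Times] continuous_intros)
  moreover have "open (- D)" "0 \<in> - D"
    using \<open>compact D\<close> \<open>0 \<notin> D\<close> by (auto intro: compact_imp_closed)
  ultimately obtain n where n: "n > 0" "\<And>y. y \<in> K \<Longrightarrow> inverse (real n) *\<^sub>R y \<in> - D"
    using exists_inverse_scaleR_compact_subset by meson
  \<comment> \<open>The \<open>n\<close> weights \<open>1/n\<close> sum to 1; the average telescopes
    to a point of \<open>- D\<close>, a contradiction.\<close>
  have "(\<Sum>i<n. inverse (real n) *\<^sub>R (x (Suc i) - x i)) \<in> D"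
    using \<open>convex D\<close> step n(1) by (intro convex_sum) auto
  moreover have "(\<Sum>i<n. inverse (real n) *\<^sub>R (x (Suc i) - x i)) = inverse (real n) *\<^sub>R (x n - x 0)"
    by (simp only: scaleR_sum_right[symmetric] sum_lessThan_telescope)
  moreover have "x n - x 0 \<in> K"
    unfolding K_def by (rule image_eqI[of _ _ "(x n, x 0)"]) (use x_dom in auto)
  ultimately show False
    using n(2) by auto
qed

definition graph_on :: "'a set \<Rightarrow> ('a \<Rightarrow> 'b set) \<Rightarrow> ('a \<times> 'b) set" where
  "graph_on C T = {(x, y). x \<in> C \<and> y \<in> T x}"

lemma convex_graph_on:
  assumes "convex C" "convex_set_valued_on C T"
  shows "convex (graph_on C T)"
  unfolding convex_alt
proof (intro ballI allI impI)
  fix p q :: "'a \<times> 'b" and u :: real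
  assume p: "p \<in> graph_on C T" and q: "q \<in> graph_on C T" and u: "0 \<le> u \<and> u \<le> 1"
  show "(1 - u) *\<^sub>R p + u *\<^sub>R q \<in> graph_on C T"
  \<comment> \<open>Convexity of a mapping only speaks of weights strictly between 0 and 1.\<close>
  proof (cases "u = 0 \<or> u = 1")
    case True
    then show ?thesis using p q by auto
  next
    case False
    with u have u: "0 < u" "u < 1" by auto
    obtain x y z w where [simp]: "p = (x, y)" "q = (z, w)"
      by fastforce
    have "x \<in> C" "z \<in> C" "y \<in> T x" "w \<in> T z"
      using p q by (auto simp: graph_on_def)
    moreover from this have "(1 - u) *\<^sub>R x + u *\<^sub>R z \<in> C"
      using assms(1) u unfolding convex_alt by auto
    moreover have "u *\<^sub>R w + (1 - u) *\<^sub>R y \<in> T (u *\<^sub>R z + (1 - u) *\<^sub>R x)"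
      using assms(2) u calculation unfolding convex_set_valued_on_def by blast
    ultimately show ?thesis
      by (simp add: graph_on_def add.commute)
  qed
qed

text \<open>The graph is closed in the product and lies in the compact set
  \<open>C \<times> D\<close>. Over \<open>x \<in> C\<close>, a point \<open>y\<close> outside the
  compact value \<open>T x\<close> is separated from it by disjoint open sets; upper semicontinuity
  keeps nearby values in the one around \<open>T x\<close>, so a box around \<open>(x, y)\<close>
  misses the graph.\<close>

lemma compact_graph_on:
  fixes C :: "'a::t2_space set" and D :: "'b::t2_space set"
  assumes "compact C" "compact D" "set_valued_map C D T"
    and usc: "upper_semicontinuous_map (top_of_set C) (top_of_set D) T"
    and closed: "\<And>x. x \<in> C \<Longrightarrow> closed (T x)"
  shows "compact (graph_on C T)"
proof -
  have hausdorff: "Hausdorff_space (euclidean :: 'b topology)"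
    unfolding Hausdorff_space_def disjnt_def open_openin[symmetric]
    using t2_space_class.hausdorff by blast
  have sub: "T x \<subseteq> D" if "x \<in> C" for x
    using assms(3) that by (auto simp: set_valued_map_def)
  have "\<exists>W. open W \<and> (x, y) \<in> W \<and> W \<subseteq> - graph_on C T" if "(x, y) \<notin> graph_on C T" for x y
  proof (cases "x \<in> C")
    case False
    have "open (- C)"
      using assms(1) by (simp add: compact_imp_closed open_Compl)
    with False show ?thesis
      by (intro exI[of _ "(- C) \<times> UNIV"]) (auto simp: graph_on_def intro: open_Times)
  next
    case True
    have "compact (T x)"
      using compact_Int_closed[OF assms(2) closed[OF True]] sub[OF True] by (simp add: Int_absorb1)
    moreover have "y \<notin> T x"
      using that True by (simp add: graph_on_def)
    ultimately have "compactin euclidean (T x)" "compactin euclidean {y}" "disjnt (T x) {y}"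
      by simp_all
    from Hausdorff_space_compact_separation[OF hausdorff this]
    obtain V U where "openin euclidean V" "openin euclidean U" "T x \<subseteq> V" "{y} \<subseteq> U" "disjnt V U" .
    then have V: "open V" "T x \<subseteq> V" and U: "open U" "y \<in> U" "V \<inter> U = {}"
      by (simp_all add: disjnt_def)
    have "openin (top_of_set D) (D \<inter> V)" "T x \<subseteq> D \<inter> V"
      using V sub[OF True] by (auto simp: openin_open)
    then obtain B where "openin (top_of_set C) B" "x \<in> B" "\<forall>z\<in>B. T z \<subseteq> D \<inter> V"
      using usc True unfolding upper_semicontinuous_map_def topspace_euclidean_subtopology by meson
    then obtain A where A: "open A" "x \<in> A" "\<And>z. z \<in> C \<inter> A \<Longrightarrow> T z \<subseteq> V"
      unfolding openin_open by auto
    show ?thesis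
      by (rule exI[of _ "A \<times> U"]) (use A U in \<open>auto simp: graph_on_def intro: open_Times\<close>)
  qed
  then have "open (- graph_on C T)"
    by (subst open_subopen) auto
  then have "compact ((C \<times> D) \<inter> graph_on C T)"
    using assms(1,2) by (intro compact_Int_closed compact_Times) (simp_all add: closed_def)
  moreover have "(C \<times> D) \<inter> graph_on C T = graph_on C T"
    using sub by (auto simp: graph_on_def)
  ultimately show ?thesis by simp
qed

theorem theorem2p1:
  fixes C :: "'a::{locally_convex_space, t2_space} set"
    and T1 T2 :: "'a \<Rightarrow> 'a set"
  assumes "C \<noteq> {}" and "convex C" and "compact C"
    and "set_valued_map C C T1" and "set_valued_map C C T2"
    and "commutative_on C T1 T2"
    and "upper_semicontinuous_map (top_of_set C) (top_of_set C) T1"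
    and "upper_semicontinuous_map (top_of_set C) (top_of_set C) T2"
    and "convex_set_valued_on C T1" and "convex_set_valued_on C T2"
    and "\<And>x. x \<in> C \<Longrightarrow> T1 x \<noteq> {} \<and> closed (T1 x)"
    and "\<And>x. x \<in> C \<Longrightarrow> T2 x \<noteq> {} \<and> closed (T2 x)"
  shows "\<exists>x\<in>C. x \<in> T1 x \<inter> T2 x"
proof -
  let ?G1 = "graph_on C T1" and ?G2 = "graph_on C T2"
  have sub: "T1 x \<subseteq> C" "T2 x \<subseteq> C" if "x \<in> C" for x
    using assms(4,5) that by (auto simp: set_valued_map_def)
  have G1: "compact ?G1" "convex ?G1" and G2: "compact ?G2" "convex ?G2"
    using assms by (auto intro: compact_graph_on convex_graph_on)
  define F where "F = {x \<in> C. x \<in> T1 x}"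
  \<comment> \<open>As a projection of the graph cut by the diagonal, a closed linear subspace,
    \<open>F\<close> inherits compactness and convexity.\<close>
  have F_eq: "F = fst ` (?G1 \<inter> range (\<lambda>x. (x, x)))"
    by (force simp: F_def graph_on_def)
  have "closed (range (\<lambda>x::'a. (x, x)))"
    using closed_diagonal by (simp add: full_SetCompr_eq)
  then have "compact F"
    unfolding F_eq using G1 by (intro compact_continuous_image continuous_intros compact_Int_closed)
  have "convex (range (\<lambda>x::'a. (x, x)))"
    by (intro convex_linear_image linearI) auto
  then have "convex F"
    unfolding F_eq using G1 by (intro convex_linear_image[OF linear_fst] convex_Int)
  have "\<exists>x. (x, x) \<in> ?G1"
  proof (rule compact_convex_relation_fixed_point[OF G1])
    have "fst ` ?G1 = C"
      using assms(11) by (force simp: graph_on_def)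
    moreover have "snd ` ?G1 \<subseteq> C"
      using sub by (force simp: graph_on_def)
    ultimately show "?G1 \<noteq> {}" "snd ` ?G1 \<subseteq> fst ` ?G1"
      using assms(1) by auto
  qed
  then have "F \<noteq> {}"
    by (auto simp: F_def graph_on_def)
  have meet: "\<exists>y\<in>T2 x. y \<in> F" if "x \<in> F" for x
  proof -
    \<comment> \<open>For \<open>z\<close> in \<open>?A\<close>, \<open>T1 z\<close> may miss
      \<open>?A\<close>, but each point of \<open>?A\<close> has a \<open>T1\<close>-predecessor in
      \<open>?A\<close>. The swap turns predecessors into the successors that the fixed point lemma
      iterates.\<close>
    let ?A = "T2 x" and ?H = "prod.swap ` (?G1 \<inter> T2 x \<times> T2 x)"
    have x: "x \<in> C" "x \<in> T1 x"
      using that by (auto simp: F_def)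
    have "?A = snd ` (?G2 \<inter> {x} \<times> UNIV)"
      using x(1) by (force simp: graph_on_def)
    then have "convex ?A"
      using G2 by (simp add: convex_linear_image[OF linear_snd] convex_Int convex_Times)
    have "set_valued_comp T2 T1 x = set_valued_comp T1 T2 x"
      using assms(6) x(1) by (simp add: commutative_on_def)
    then have pre: "\<exists>z\<in>?A. y \<in> T1 z" if "y \<in> ?A" for y
      using that x(2) by (auto simp: set_valued_comp_def)
    have "\<exists>y. (y, y) \<in> ?H"
    proof (rule compact_convex_relation_fixed_point)
      show "compact ?H"
        using G1 assms(12)[OF x(1)]
        by (intro compact_continuous_image continuous_on_swap compact_Int_closed closed_Times) auto
      show "convex ?H"
        using G1 \<open>convex ?A\<close> by (intro convex_linear_image convex_Int convex_Times linearI) auto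
      have "fst ` ?H = ?A"
        using pre sub(2)[OF x(1)] by (force simp: graph_on_def)
      then show "?H \<noteq> {}" "snd ` ?H \<subseteq> fst ` ?H"
        using assms(12)[OF x(1)] by auto
    qed
    then show ?thesis
      by (auto simp: F_def graph_on_def)
  qed
  have "\<exists>x. (x, x) \<in> ?G2 \<inter> F \<times> F"
  proof (rule compact_convex_relation_fixed_point)
    show "compact (?G2 \<inter> F \<times> F)"
      using G2 \<open>compact F\<close> by (intro compact_Int_closed closed_Times compact_imp_closed)
    show "convex (?G2 \<inter> F \<times> F)"
      using G2 \<open>convex F\<close> by (intro convex_Int convex_Times)
    \<comment> \<open>By \<open>meet\<close>, every point of \<open>F\<close> has a successor under
      \<open>T2\<close> inside \<open>F\<close>.\<close>
    have "fst ` (?G2 \<inter> F \<times> F) = F"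
      using meet by (force simp: F_def graph_on_def)
    then show "?G2 \<inter> F \<times> F \<noteq> {}" "snd ` (?G2 \<inter> F \<times> F) \<subseteq> fst ` (?G2 \<inter> F \<times> F)"
      using \<open>F \<noteq> {}\<close> by auto
  qed
  then show ?thesis
    by (auto simp: F_def graph_on_def)
qed

end
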